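(* Let $\alpha,\beta\in\mathbb{C}$ be nonzero with $|\alpha|^2+|\beta|^2=1$. Then $$H^2_{\alpha,\beta}=\big[H^2_{\alpha,\beta}\ominus S_{\alpha,\beta}H^2_{\alpha,\beta}\big]_{S_{\alpha,\beta}}$$ if and only if $|\alpha|^2\le\frac{1}{u+1}$, where $u$ is the unique real root of the cubic polynomial $z^3+3z^2+2z-1$.
   Context: $H^2(\mathbb{D})$ is the Hardy space of the open unit disc. Let $H^2_{\alpha,\beta}=\overline{\mathrm{span}}\{\alpha+\beta z,\ z^n: n\ge 2\}$, a closed subspace of $H^2(\mathbb{D})$. Let $P_{H^2_{\alpha,\beta}}$ be the orthogonal projection of $H^2(\mathbb{D})$ onto $H^2_{\alpha,\beta}$, $M_z$ multiplication by $z$ on $H^2(\mathbb{D})$, and $S_{\alpha,\beta}=P_{H^2_{\alpha,\beta}}M_z|_{H^2_{\alpha,\beta}}$. For an operator $T$ on a Hilbert space and a subset $E$, $[E]_T$ is the closed linear span of $\{T^nh: h\in E,\ n\ge0\}$. $\mathcal{M}\ominus\mathcal{N}$ denotes the orthogonal complement of $\mathcal{N}$ in $\mathcal{M}$. *)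

theory Defs
  imports "HOL-Complex_Analysis.Complex_Analysis"
begin

definition taylor_coeff :: "(complex \<Rightarrow> complex) \<Rightarrow> nat \<Rightarrow> complex" where
  "taylor_coeff f n = fps_nth (fps_expansion f 0) n"

text \<open>
  The Hardy space of the open unit disc: the holomorphic functions on the disc with square-summable
  Taylor coefficients at the origin.  Extending them by zero to the whole plane makes equality of
  elements the same as equality on the disc.
\<close>

definition hardy_set :: "(complex \<Rightarrow> complex) set" where
  "hardy_set = {f. f holomorphic_on ball 0 1 \<and> (\<forall>z. z \<notin> ball 0 1 \<longrightarrow> f z = 0) \<and>
                   summable (\<lambda>n. (cmod (taylor_coeff f n))\<^sup>2)}"

lemma taylor_coeff_cong:
  assumes "\<And>z. z \<in> ball 0 1 \<Longrightarrow> f z = g z"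
  shows "taylor_coeff f = taylor_coeff g"
proof -
  have "eventually (\<lambda>z. z \<in> ball 0 (1::real)) (nhds (0::complex))"
    by (intro eventually_nhds_in_open) auto
  then have "eventually (\<lambda>z. f z = g z) (nhds 0)"
    by eventually_elim (use assms in auto)
  then have "fps_expansion f 0 = fps_expansion g 0"
    by (rule fps_expansion_cong)
  then show ?thesis
    by (simp add: taylor_coeff_def fun_eq_iff)
qed

lemma has_fps_imp_taylor_coeff: "f has_fps_expansion F \<Longrightarrow> taylor_coeff f n = fps_nth F n"
  by (simp add: taylor_coeff_def fps_nth_fps_expansion fps_expansion_def)

lemma holomorphic_has_fps:
  "f holomorphic_on ball 0 1 \<Longrightarrow> f has_fps_expansion fps_expansion f 0"
  by (rule has_fps_expansion_fps_expansion[of "ball 0 1"]) auto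

lemma taylor_coeff_add:
  assumes "f holomorphic_on ball 0 1" "g holomorphic_on ball 0 1"
  shows "taylor_coeff (\<lambda>z. f z + g z) n = taylor_coeff f n + taylor_coeff g n"
  using has_fps_imp_taylor_coeff[OF has_fps_expansion_add[OF assms[THEN holomorphic_has_fps]]]
  by (simp add: taylor_coeff_def)

lemma taylor_coeff_cmult:
  assumes "f holomorphic_on ball 0 1"
  shows "taylor_coeff (\<lambda>z. c * f z) n = c * taylor_coeff f n"
  using has_fps_imp_taylor_coeff[OF has_fps_expansion_cmult_left[OF holomorphic_has_fps[OF assms]]]
  by (simp add: taylor_coeff_def)

lemma taylor_coeff_mult_z:
  assumes "f holomorphic_on ball 0 1"
  shows "taylor_coeff (\<lambda>z. z * f z) n = (if n = 0 then 0 else taylor_coeff f (n - 1))"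
  using has_fps_imp_taylor_coeff[OF has_fps_expansion_mult[OF has_fps_expansion_fps_X
      holomorphic_has_fps[OF assms]]]
  by (simp add: taylor_coeff_def)

lemma taylor_coeff_power: "taylor_coeff (\<lambda>z. z ^ k) n = (if n = k then 1 else 0)"
  using has_fps_imp_taylor_coeff[OF has_fps_expansion_fps_X_power] by simp

lemma taylor_coeff_zero: "taylor_coeff (\<lambda>z. 0) n = 0"
  using has_fps_imp_taylor_coeff[OF has_fps_expansion_0] by simp

lemma norm_add_square_le: "(norm (a + b))\<^sup>2 \<le> 2 * (norm a)\<^sup>2 + 2 * (norm (b::complex))\<^sup>2"
proof -
  have "(norm (a + b))\<^sup>2 \<le> (norm a + norm b)\<^sup>2"
    by (intro power_mono norm_triangle_ineq) auto
  also have "\<dots> \<le> 2 * (norm a)\<^sup>2 + 2 * (norm b)\<^sup>2"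
    using zero_le_power2[of "norm a - norm b"] by (simp add: power2_eq_square algebra_simps)
  finally show ?thesis .
qed

lemma hardy_zero: "(\<lambda>z. 0) \<in> hardy_set"
  by (simp add: hardy_set_def taylor_coeff_zero)

lemma hardy_add:
  assumes "f \<in> hardy_set" "g \<in> hardy_set"
  shows "(\<lambda>z. f z + g z) \<in> hardy_set"
proof -
  have "summable (\<lambda>n. 2 * (cmod (taylor_coeff f n))\<^sup>2 + 2 * (cmod (taylor_coeff g n))\<^sup>2)"
    using assms by (intro summable_add summable_mult) (auto simp: hardy_set_def)
  then have "summable (\<lambda>n. (cmod (taylor_coeff f n + taylor_coeff g n))\<^sup>2)"
    by (rule summable_comparison_test') (simp add: norm_add_square_le)
  then show ?thesis
    using assms by (auto simp: hardy_set_def taylor_coeff_add intro!: holomorphic_intros)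
qed

lemma hardy_cmult:
  assumes "f \<in> hardy_set"
  shows "(\<lambda>z. c * f z) \<in> hardy_set"
  using assms by (auto simp: hardy_set_def taylor_coeff_cmult norm_mult power_mult_distrib
      intro!: holomorphic_intros summable_mult)

lemma hardy_mult_z:
  assumes "f \<in> hardy_set"
  shows "(\<lambda>z. z * f z) \<in> hardy_set"
proof -
  have "summable (\<lambda>n. (cmod (taylor_coeff (\<lambda>z. z * f z) (Suc n)))\<^sup>2)"
    using assms by (simp add: hardy_set_def taylor_coeff_mult_z)
  then have "summable (\<lambda>n. (cmod (taylor_coeff (\<lambda>z. z * f z) n))\<^sup>2)"
    by (subst (asm) summable_Suc_iff)
  then show ?thesis
    using assms by (auto simp: hardy_set_def intro!: holomorphic_intros)
qed

lemma hardy_power: "(\<lambda>z. if z \<in> ball 0 1 then z ^ k else 0) \<in> hardy_set"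
proof -
  have "taylor_coeff (\<lambda>z. if z \<in> ball 0 1 then z ^ k else 0) = taylor_coeff (\<lambda>z. z ^ k)"
    by (rule taylor_coeff_cong) auto
  moreover have "(\<lambda>z. if z \<in> ball 0 1 then z ^ k else 0) holomorphic_on ball 0 (1::real)"
    by (rule holomorphic_transform[of "\<lambda>z. z ^ k"]) (auto intro!: holomorphic_intros)
  moreover have "summable (\<lambda>n. (cmod (if n = k then 1 else 0))\<^sup>2)"
    by (rule summable_finite[of "{k}"]) auto
  ultimately show ?thesis
    by (auto simp: hardy_set_def taylor_coeff_power)
qed

typedef hardy = hardy_set
  morphisms hardy_fun Abs_hardy
  using hardy_zero by blast

setup_lifting type_definition_hardy

lift_definition hcoeff :: "hardy \<Rightarrow> nat \<Rightarrow> complex" is taylor_coeff .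

lift_definition hscale :: "complex \<Rightarrow> hardy \<Rightarrow> hardy" is "\<lambda>c f z. c * f z"
  by (rule hardy_cmult)

lift_definition hmonom :: "nat \<Rightarrow> hardy" is "\<lambda>n z. if z \<in> ball 0 1 then z ^ n else 0"
  by (rule hardy_power)

lift_definition Mz :: "hardy \<Rightarrow> hardy" is "\<lambda>f z. z * f z"
  by (rule hardy_mult_z)

instantiation hardy :: real_vector
begin

lift_definition zero_hardy :: hardy is "\<lambda>z. 0"
  by (rule hardy_zero)
lift_definition plus_hardy :: "hardy \<Rightarrow> hardy \<Rightarrow> hardy" is "\<lambda>f g z. f z + g z"
  by (rule hardy_add)
lift_definition uminus_hardy :: "hardy \<Rightarrow> hardy" is "\<lambda>f z. - f z"
  using hardy_cmult[of _ "-1"] by simp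
lift_definition minus_hardy :: "hardy \<Rightarrow> hardy \<Rightarrow> hardy" is "\<lambda>f g z. f z - g z"
  using hardy_add[OF _ hardy_cmult[of _ "-1"]] by simp
lift_definition scaleR_hardy :: "real \<Rightarrow> hardy \<Rightarrow> hardy" is "\<lambda>r f z. of_real r * f z"
  by (rule hardy_cmult)

instance
  by (intro_classes; transfer) (simp_all add: algebra_simps fun_eq_iff)

end

global_interpretation hardy_complex: vector_space hscale
  defines cspan = hardy_complex.span
  by standard (transfer, simp add: algebra_simps fun_eq_iff)+

lemma scaleR_hardy_eq: "r *\<^sub>R f = hscale (complex_of_real r) f"
  by transfer simp

lemma hardy_holomorphic: "hardy_fun f holomorphic_on ball 0 1"
  using hardy_fun[of f] by (auto simp: hardy_set_def)

lemma hcoeff_add: "hcoeff (f + g) n = hcoeff f n + hcoeff g n"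
  by transfer (auto simp: hardy_set_def taylor_coeff_add)

lemma hcoeff_scale: "hcoeff (hscale c f) n = c * hcoeff f n"
  by transfer (auto simp: hardy_set_def taylor_coeff_cmult)

lemma hcoeff_zero: "hcoeff 0 n = 0"
  by transfer (simp add: taylor_coeff_zero)

lemma hcoeff_monom: "hcoeff (hmonom k) n = (if n = k then 1 else 0)"
proof -
  have "hcoeff (hmonom k) = taylor_coeff (\<lambda>z. z ^ k)"
    by transfer (rule taylor_coeff_cong, simp)
  then show ?thesis by (simp add: taylor_coeff_power)
qed

lemma hcoeff_Mz: "hcoeff (Mz f) n = (if n = 0 then 0 else hcoeff f (n - 1))"
  by transfer (auto simp: hardy_set_def taylor_coeff_mult_z)

lemma hcoeff_sums:
  assumes "z \<in> ball 0 1"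
  shows "(\<lambda>n. hcoeff f n * z ^ n) sums hardy_fun f z"
  using holomorphic_power_series[OF hardy_holomorphic assms, of f]
  by (simp add: hcoeff.rep_eq taylor_coeff_def fps_expansion_def)

lemma hcoeff_summable: "summable (\<lambda>n. (cmod (hcoeff f n))\<^sup>2)"
  by transfer (simp add: hardy_set_def)

lemma hardy_eqI:
  assumes "\<And>n. hcoeff f n = hcoeff g n"
  shows "f = g"
proof -
  have "hardy_fun f z = hardy_fun g z" for z
  proof (cases "z \<in> ball 0 1")
    case True
    show ?thesis
      using hcoeff_sums[OF True, of f] hcoeff_sums[OF True, of g] assms
      by (simp add: sums_unique2)
  next
    case False
    then show ?thesis using hardy_fun[of f] hardy_fun[of g] by (simp add: hardy_set_def)
  qed
  then show ?thesis by (simp add: hardy_fun_inject[symmetric] fun_eq_iff)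
qed

definition hinner :: "hardy \<Rightarrow> hardy \<Rightarrow> complex" where
  "hinner f g = (\<Sum>n. hcoeff f n * cnj (hcoeff g n))"

lemma hinner_abs_summable: "summable (\<lambda>n. norm (hcoeff f n * cnj (hcoeff g n)))"
proof (rule summable_comparison_test')
  show "summable (\<lambda>n. (cmod (hcoeff f n))\<^sup>2 + (cmod (hcoeff g n))\<^sup>2)"
    by (intro summable_add hcoeff_summable)
  show "norm (norm (hcoeff f n * cnj (hcoeff g n))) \<le> (cmod (hcoeff f n))\<^sup>2 + (cmod (hcoeff g n))\<^sup>2" for n
  proof -
    have "2 * (cmod (hcoeff f n) * cmod (hcoeff g n)) \<le> (cmod (hcoeff f n))\<^sup>2 + (cmod (hcoeff g n))\<^sup>2"
      using zero_le_power2[of "cmod (hcoeff f n) - cmod (hcoeff g n)"]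
      by (simp add: power2_eq_square algebra_simps)
    moreover have "0 \<le> cmod (hcoeff f n) * cmod (hcoeff g n)" by simp
    ultimately have "cmod (hcoeff f n) * cmod (hcoeff g n) \<le> (cmod (hcoeff f n))\<^sup>2 + (cmod (hcoeff g n))\<^sup>2"
      by linarith
    then show ?thesis by (simp add: norm_mult)
  qed
qed

lemmas hinner_summable = summable_norm_cancel[OF hinner_abs_summable]

lemma hinner_add_left: "hinner (f + g) h = hinner f h + hinner g h"
  by (simp add: hinner_def hcoeff_add distrib_right suminf_add hinner_summable)

lemma hinner_scale_left: "hinner (hscale c f) g = c * hinner f g"
  by (simp add: hinner_def hcoeff_scale mult.assoc suminf_mult hinner_summable)

lemma hinner_commute: "hinner g f = cnj (hinner f g)"
proof -
  have "(\<lambda>n. cnj (hcoeff f n * cnj (hcoeff g n))) sums cnj (hinner f g)"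
    unfolding hinner_def sums_cnj by (rule summable_sums[OF hinner_summable])
  then show ?thesis
    by (simp add: hinner_def sums_iff mult.commute)
qed

lemma hinner_self: "hinner f f = of_real (\<Sum>n. (cmod (hcoeff f n))\<^sup>2)"
  unfolding hinner_def complex_norm_square[symmetric]
  by (rule suminf_of_real[OF hcoeff_summable, symmetric])

text \<open>
  The library has only real inner product spaces, so the class inner product is the real part of
  the complex one.  The induced norm and topology are those of the complex inner product.
\<close>

instantiation hardy :: real_inner
begin

definition inner_hardy :: "hardy \<Rightarrow> hardy \<Rightarrow> real" where
  "inner_hardy f g = Re (hinner f g)"
definition norm_hardy :: "hardy \<Rightarrow> real" where
  "norm_hardy f = sqrt (Re (hinner f f))"
definition dist_hardy :: "hardy \<Rightarrow> hardy \<Rightarrow> real" where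
  "dist_hardy f g = norm (f - g)"
definition sgn_hardy :: "hardy \<Rightarrow> hardy" where
  "sgn_hardy f = f /\<^sub>R norm f"
definition uniformity_hardy :: "(hardy \<times> hardy) filter" where
  "uniformity_hardy = (INF e\<in>{0<..}. principal {(x, y). dist x y < e})"
definition open_hardy :: "hardy set \<Rightarrow> bool" where
  "open_hardy S = (\<forall>x\<in>S. \<forall>\<^sub>F (x', y) in uniformity. x' = x \<longrightarrow> y \<in> S)"

instance
proof
  fix x y z :: hardy and r :: real and S :: "hardy set"
  show "dist x y = norm (x - y)" by (rule dist_hardy_def)
  show "sgn x = x /\<^sub>R norm x" by (rule sgn_hardy_def)
  show "(uniformity :: (hardy \<times> hardy) filter) = (INF e\<in>{0<..}. principal {(x, y). dist x y < e})"
    by (rule uniformity_hardy_def)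
  show "open S = (\<forall>x\<in>S. \<forall>\<^sub>F (x', y) in uniformity. x' = x \<longrightarrow> y \<in> S)"
    by (rule open_hardy_def)
  show "inner x y = inner y x"
    unfolding inner_hardy_def by (subst hinner_commute) simp
  show "inner (x + y) z = inner x z + inner y z"
    by (simp add: inner_hardy_def hinner_add_left)
  show "inner (r *\<^sub>R x) y = r * inner x y"
    by (simp add: inner_hardy_def scaleR_hardy_eq hinner_scale_left)
  show "0 \<le> inner x x"
    by (simp add: inner_hardy_def hinner_self suminf_nonneg hcoeff_summable)
  show "inner x x = 0 \<longleftrightarrow> x = 0"
  proof
    assume "inner x x = 0"
    then have "\<forall>n. (cmod (hcoeff x n))\<^sup>2 = 0"
      by (subst suminf_eq_zero_iff[symmetric])
         (simp_all add: inner_hardy_def hinner_self hcoeff_summable)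
    then show "x = 0" by (intro hardy_eqI) (simp add: hcoeff_zero)
  next
    assume "x = 0"
    then show "inner x x = 0" by (simp add: inner_hardy_def hinner_def hcoeff_zero)
  qed
  show "norm x = sqrt (inner x x)"
    by (simp add: norm_hardy_def inner_hardy_def)
qed

end

definition H2_sub :: "complex \<Rightarrow> complex \<Rightarrow> hardy set" where
  "H2_sub \<alpha> \<beta> = closure (cspan (insert (hscale \<alpha> (hmonom 0) + hscale \<beta> (hmonom 1))
                                      {hmonom n | n. n \<ge> 2}))"

text \<open>Meaningful only if \<open>M\<close> is a closed complex subspace, where such a \<open>g\<close> exists and is unique.\<close>

definition orth_proj :: "hardy set \<Rightarrow> hardy \<Rightarrow> hardy" where
  "orth_proj M f = (THE g. g \<in> M \<and> (\<forall>h\<in>M. hinner (f - g) h = 0))"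

definition ominus :: "hardy set \<Rightarrow> hardy set \<Rightarrow> hardy set"  (infixl "\<ominus>\<^sub>H" 65) where
  "M \<ominus>\<^sub>H N = {f \<in> M. \<forall>g\<in>N. hinner f g = 0}"

text \<open>
  The operator \<open>S_op \<alpha> \<beta>\<close> is meant on \<open>H2_sub \<alpha> \<beta>\<close>, which it maps into itself; its values elsewhere
  play no role.
\<close>

definition S_op :: "complex \<Rightarrow> complex \<Rightarrow> hardy \<Rightarrow> hardy" where
  "S_op \<alpha> \<beta> f = orth_proj (H2_sub \<alpha> \<beta>) (Mz f)"

definition generated :: "(hardy \<Rightarrow> hardy) \<Rightarrow> hardy set \<Rightarrow> hardy set" where
  "generated T E = closure (cspan {(T ^^ n) h | n h. h \<in> E})"

end

theory Submission
  imports Defs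
begin

text \<open>
  In the orthonormal basis \<open>e = \<alpha> + \<beta> z, z\<^sup>2, z\<^sup>3, \<dots>\<close> of the subspace, the compressed shift \<open>S\<close> sends
  \<open>z\<^sup>n\<close> to \<open>z\<^bsup>n+1\<^esup>\<close> and \<open>e\<close> to \<open>\<lambda> e + \<beta> z\<^sup>2\<close> with \<open>\<lambda> = \<alpha> \<beta>\<^sup>*\<close> (a star denotes the complex conjugate).
  Hence the orthogonal complement of its range is the line through one vector \<open>h = e + \<mu> z\<^sup>2\<close> with
  \<open>\<bar>\<mu>\<bar> = \<bar>\<alpha>\<bar>\<close>, and the question is whether \<open>h\<close> is cyclic.

  Sending \<open>e\<close> to \<open>\<beta>/(z - \<lambda>)\<close> and \<open>z\<^bsup>n+2\<^esup>\<close> to \<open>z\<^sup>n\<close> turns \<open>S\<close> into multiplication by \<open>z\<close> on the sum of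
  the Hardy space and the line through \<open>1/(z - \<lambda>)\<close>, and \<open>h\<close> into \<open>(A + \<mu> z)/(z - \<lambda>)\<close> with
  \<open>A = \<beta> (1 + \<bar>\<alpha>\<bar>\<^sup>2)\<close>.  After multiplication by \<open>z - \<lambda>\<close>, cyclicity says that the polynomial multiples
  of \<open>A + \<mu> z\<close> are dense in the Hardy space.  This holds exactly when \<open>A + \<mu> z\<close> has no zero in the open
  disc, that is, when \<open>\<bar>\<mu>\<bar> \<le> \<bar>A\<bar>\<close>.  The model only guides the proof.  If there is no zero, Cesaro means
  (\<open>monom_mem_if_outer\<close>) approximate each \<open>z\<^sup>n\<close> with \<open>n \<ge> 2\<close> (\<open>generates_if_outer\<close>).  If there is a zero
  \<open>w\<close>, evaluation at \<open>w\<close> in the model is a nonzero continuous functional that vanishes on all \<open>S\<^sup>n h\<close>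
  (\<open>not_generates_if_not_outer\<close>).

  Squaring \<open>\<bar>\<mu>\<bar> \<le> \<bar>A\<bar>\<close> gives \<open>a \<le> (1 - a)(1 + a)\<^sup>2\<close> for \<open>a = \<bar>\<alpha>\<bar>\<^sup>2\<close>.  The substitution \<open>a = 1/(t + 1)\<close>
  makes this \<open>t\<^sup>3 + 3 t\<^sup>2 + 2 t - 1 \<ge> 0\<close>, which for positive \<open>t\<close> means that \<open>t\<close> is at least the root.
\<close>

section \<open>Coefficients, monomials and closed subspaces of the Hardy space\<close>

lemma hcoeff_uminus: "hcoeff (- f) n = - hcoeff f n"
  using hcoeff_scale[of "-1" f n] scaleR_hardy_eq[of "-1" f] by simp

lemma hcoeff_diff: "hcoeff (f - g) n = hcoeff f n - hcoeff g n"
  using hcoeff_add[of f "- g" n] by (simp add: hcoeff_uminus)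

lemma hcoeff_sum: "hcoeff (sum f A) n = (\<Sum>i\<in>A. hcoeff (f i) n)"
  by (induction A rule: infinite_finite_induct) (auto simp: hcoeff_zero hcoeff_add)

lemmas hcoeff_simps =
  hcoeff_add hcoeff_diff hcoeff_scale hcoeff_monom hcoeff_Mz hcoeff_zero hcoeff_sum

lemma hardy_fun_simps:
  "hardy_fun (f + g) z = hardy_fun f z + hardy_fun g z"
  "hardy_fun (f - g) z = hardy_fun f z - hardy_fun g z"
  "hardy_fun (hscale c f) z = c * hardy_fun f z"
  "hardy_fun (Mz f) z = z * hardy_fun f z"
  "z \<in> ball 0 1 \<Longrightarrow> hardy_fun (hmonom n) z = z ^ n"
  by (transfer; simp)+

lemma hinner_diff_left: "hinner (f - g) h = hinner f h - hinner g h"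
  using hinner_add_left[of "f - g" g h] by simp

lemma hinner_add_right: "hinner h (f + g) = hinner h f + hinner h g"
  by (metis hinner_commute hinner_add_left complex_cnj_add)

lemma hinner_scale_right: "hinner h (hscale c f) = cnj c * hinner h f"
  by (metis hinner_commute hinner_scale_left complex_cnj_mult)

lemma hinner_monom: "hinner f (hmonom n) = hcoeff f n"
proof -
  have "(\<lambda>k. hcoeff f k * cnj (hcoeff (hmonom n) k)) = (\<lambda>k. if k = n then hcoeff f k else 0)"
    by (auto simp: hcoeff_monom)
  then show ?thesis
    unfolding hinner_def by (simp add: sums_unique[OF sums_single, symmetric])
qed

lemmas hinner_simps =
  hinner_add_left hinner_diff_left hinner_scale_left hinner_add_right hinner_scale_right hinner_monom

lemma norm_hardy_sq: "(norm f)\<^sup>2 = (\<Sum>n. (cmod (hcoeff f n))\<^sup>2)" for f :: hardy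
  by (simp add: norm_hardy_def hinner_self suminf_nonneg hcoeff_summable)

lemma cmod_hcoeff_le_norm: "cmod (hcoeff f n) \<le> norm f"
proof -
  have "(cmod (hcoeff f n))\<^sup>2 \<le> (norm f)\<^sup>2"
    unfolding norm_hardy_sq using sum_le_suminf[OF hcoeff_summable, of "{n}" f] by simp
  then show ?thesis
    by (rule power2_le_imp_le) simp
qed

lemma norm_hscale: "norm (hscale c f) = cmod c * norm f"
proof -
  have "(norm (hscale c f))\<^sup>2 = (cmod c * norm f)\<^sup>2"
    unfolding power_mult_distrib norm_hardy_sq
    by (simp add: hcoeff_scale norm_mult power_mult_distrib suminf_mult hcoeff_summable)
  then show ?thesis
    by (simp add: power2_eq_iff_nonneg)
qed

lemma bounded_linear_hcoeff: "bounded_linear (\<lambda>f. hcoeff f n)"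
  by (rule bounded_linear_intro[where K = 1])
     (auto simp: hcoeff_add hcoeff_scale scaleR_hardy_eq scaleR_conv_of_real cmod_hcoeff_le_norm)

lemma bounded_linear_hscale: "bounded_linear (hscale c)"
  by (rule bounded_linear_intro[where K = "cmod c"])
     (auto simp: scaleR_hardy_eq hardy_complex.scale_right_distrib mult.commute norm_hscale)

text \<open>
  Each coefficient is at most the norm, so the value at a point \<open>w\<close> of the disc is dominated by the
  norm times the geometric series of \<open>\<bar>w\<bar>\<close>.
\<close>

lemma bounded_linear_hardy_eval:
  assumes "w \<in> ball 0 1"
  shows "bounded_linear (\<lambda>f. hardy_fun f w)"
proof (rule bounded_linear_intro[where K = "1 / (1 - cmod w)"])
  fix f :: hardy
  have w: "cmod w < 1"
    using assms by simp
  have geo: "summable (\<lambda>n. norm f * cmod w ^ n)"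
    using w by (intro summable_mult summable_geometric) auto
  have "norm (\<Sum>n. hcoeff f n * w ^ n) \<le> (\<Sum>n. norm f * cmod w ^ n)"
    by (intro norm_suminf_le geo)
       (auto simp: norm_mult norm_power cmod_hcoeff_le_norm intro!: mult_right_mono)
  also have "\<dots> = norm f * (1 / (1 - cmod w))"
    using w by (subst suminf_mult) (auto simp: suminf_geometric intro!: summable_geometric)
  finally show "norm (hardy_fun f w) \<le> norm f * (1 / (1 - cmod w))"
    using sums_unique[OF hcoeff_sums[OF assms, of f]] by simp
qed (auto simp: hardy_fun_simps scaleR_hardy_eq scaleR_conv_of_real)

lemma closure_hardy_subspace:
  assumes "hardy_complex.subspace V"
  shows "hardy_complex.subspace (closure V)"
proof (rule hardy_complex.subspaceI)
  show "0 \<in> closure V"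
    using hardy_complex.subspace_0[OF assms] closure_subset by auto
next
  fix f g assume "f \<in> closure V" "g \<in> closure V"
  then obtain p q where "\<And>n. p n \<in> V" "p \<longlonglongrightarrow> f" "\<And>n. q n \<in> V" "q \<longlonglongrightarrow> g"
    by (metis closure_sequential)
  then have "\<And>n. p n + q n \<in> V" "(\<lambda>n. p n + q n) \<longlonglongrightarrow> f + g"
    by (auto intro: tendsto_add hardy_complex.subspace_add[OF assms])
  then show "f + g \<in> closure V"
    unfolding closure_sequential by (intro exI[of _ "\<lambda>n. p n + q n"]) auto
next
  fix c f assume "f \<in> closure V"
  then obtain p where "\<And>n. p n \<in> V" "p \<longlonglongrightarrow> f"
    by (metis closure_sequential)
  then have "\<And>n. hscale c (p n) \<in> V" "(\<lambda>n. hscale c (p n)) \<longlonglongrightarrow> hscale c f"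
    by (auto intro: bounded_linear.tendsto[OF bounded_linear_hscale]
        hardy_complex.subspace_scale[OF assms])
  then show "hscale c f \<in> closure V"
    unfolding closure_sequential by (intro exI[of _ "\<lambda>n. hscale c (p n)"]) auto
qed

lemma closure_cspan_subset:
  assumes "closed V" "hardy_complex.subspace V" "B \<subseteq> V"
  shows "closure (cspan B) \<subseteq> V"
  using assms by (intro closure_minimal hardy_complex.span_minimal) auto

lemma orth_proj_unique:
  assumes V: "hardy_complex.subspace V"
    and p: "p \<in> V" "\<And>h. h \<in> V \<Longrightarrow> hinner (f - p) h = 0"
  shows "orth_proj V f = p"
  unfolding orth_proj_def
proof (rule the_equality)
  fix g assume g: "g \<in> V \<and> (\<forall>h\<in>V. hinner (f - g) h = 0)"
  then have d: "g - p \<in> V"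
    using p by (auto intro: hardy_complex.subspace_diff[OF V])
  have "hinner (g - p) (g - p) = hinner (f - p) (g - p) - hinner (f - g) (g - p)"
    by (simp add: hinner_diff_left)
  also have "\<dots> = 0"
    using p(2)[OF d] g d by simp
  finally have "norm (g - p) = 0"
    unfolding norm_hardy_def by simp
  then show "g = p"
    by simp
qed (use p in auto)

lemma monomial_expansion:
  "(\<lambda>N. \<Sum>n<N. hscale (hcoeff f n) (hmonom n)) \<longlonglongrightarrow> f"
proof -
  define s where "s N = (\<Sum>n<N. hscale (hcoeff f n) (hmonom n))" for N
  have s: "hcoeff (s N) n = (if n < N then hcoeff f n else 0)" for N n
    by (simp add: s_def hcoeff_simps if_distrib[of "\<lambda>x. _ * x"] cong: if_cong)
  have rest: "(norm (s N - f))\<^sup>2 = (\<Sum>n. (cmod (hcoeff f (n + N)))\<^sup>2)" for N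
  proof -
    have "(norm (s N - f))\<^sup>2 = (\<Sum>n. (cmod (hcoeff (s N - f) (n + N)))\<^sup>2)
            + (\<Sum>n<N. (cmod (hcoeff (s N - f) n))\<^sup>2)"
      unfolding norm_hardy_sq by (rule suminf_split_initial_segment[OF hcoeff_summable])
    then show ?thesis
      by (simp add: hcoeff_diff s)
  qed
  have "(\<lambda>N. (norm (s N - f))\<^sup>2) \<longlonglongrightarrow> 0"
    unfolding rest by (rule suminf_exist_split2[OF hcoeff_summable])
  then have "(\<lambda>N. norm (s N - f)) \<longlonglongrightarrow> 0"
    by (simp add: power_tendsto_0_iff)
  then show ?thesis
    unfolding s_def tendsto_norm_zero_iff by (rule LIM_zero_cancel)
qed

text \<open>
  Here the polynomial \<open>1 + r z\<close> is outer.  The geometric inverse need not converge when \<open>\<bar>r\<bar> = 1\<close>, but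
  its Cesaro means do the job: with \<open>v\<^sub>k = (-r)\<^sup>k z\<^bsup>m+k\<^esup>\<close> the hypothesis puts every \<open>v\<^sub>k - v\<^sub>k\<^sub>+\<^sub>1\<close>, hence
  every \<open>v\<^sub>0 - v\<^sub>k\<close>, into \<open>V\<close>, and the average of \<open>v\<^sub>1, \<dots>, v\<^sub>N\<close>, being one of \<open>N\<close> orthogonal vectors of
  norm at most 1, has norm at most \<open>1/\<surd>N\<close>.
\<close>

lemma monom_mem_if_outer:
  assumes V: "closed V" "hardy_complex.subspace V"
    and r: "cmod r \<le> 1"
    and mem: "\<And>k. k \<ge> m \<Longrightarrow> hmonom k + hscale r (hmonom (Suc k)) \<in> V"
  shows "hmonom m \<in> V"
proof -
  define v where "v k = hscale ((- r) ^ k) (hmonom (m + k))" for k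
  define a where "a N = hscale (1 / of_nat (Suc N)) (\<Sum>k=1..Suc N. hmonom m - v k)" for N
  have step: "v k - v (Suc k) \<in> V" for k
  proof -
    have "v k - v (Suc k) = hscale ((- r) ^ k) (hmonom (m + k) + hscale r (hmonom (Suc (m + k))))"
      by (rule hardy_eqI) (auto simp: v_def hcoeff_simps)
    then show ?thesis
      using mem[of "m + k"] by (simp add: hardy_complex.subspace_scale[OF V(2)])
  qed
  have "hmonom m - v k \<in> V" for k
  proof (induction k)
    case 0
    then show ?case
      by (simp add: v_def hardy_complex.subspace_0[OF V(2)])
  next
    case (Suc k)
    then show ?case
      using hardy_complex.subspace_add[OF V(2) Suc step[of k]] by simp
  qed
  then have a_mem: "a N \<in> V" for N
    unfolding a_def
    by (intro hardy_complex.subspace_scale[OF V(2)] hardy_complex.subspace_sum[OF V(2)])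
  have a_coeff: "hcoeff (a N - hmonom m) n =
      (if n \<in> {m+1..m+Suc N} then - ((- r) ^ (n - m)) / of_nat (Suc N) else 0)" for N n
  proof -
    have "(\<Sum>k=1..Suc N. hcoeff (v k) n)
            = (\<Sum>k=1..Suc N. if k = n - m \<and> n \<ge> m then (- r) ^ (n - m) else 0)"
      by (rule sum.cong) (auto simp: v_def hcoeff_simps)
    also have "\<dots> = (if n \<in> {m+1..m+Suc N} then (- r) ^ (n - m) else 0)"
      by (cases "n \<ge> m") auto
    finally have "(\<Sum>k=1..Suc N. hcoeff (v k) n)
            = (if n \<in> {m+1..m+Suc N} then (- r) ^ (n - m) else 0)" .
    then have "hcoeff (a N - hmonom m) n = 1 / of_nat (Suc N) * (of_nat (Suc N) * hcoeff (hmonom m) n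
        - (if n \<in> {m+1..m+Suc N} then (- r) ^ (n - m) else 0)) - hcoeff (hmonom m) n"
      unfolding a_def hcoeff_diff hcoeff_scale hcoeff_sum sum_subtractf
      by (simp only: sum_constant card_atLeastAtMost) simp
    also have "\<dots> = (if n \<in> {m+1..m+Suc N} then - ((- r) ^ (n - m)) / of_nat (Suc N) else 0)"
      by (simp add: field_simps del: of_nat_Suc)
    finally show ?thesis .
  qed
  have bound: "(norm (a N - hmonom m))\<^sup>2 \<le> 1 / real (Suc N)" for N
  proof -
    have "(norm (a N - hmonom m))\<^sup>2 = (\<Sum>n\<in>{m+1..m+Suc N}. (cmod (hcoeff (a N - hmonom m) n))\<^sup>2)"
      unfolding norm_hardy_sq by (rule suminf_finite) (auto simp: a_coeff)
    also have "\<dots> \<le> (\<Sum>n\<in>{m+1..m+Suc N}. 1 / (real (Suc N))\<^sup>2)"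
    proof (rule sum_mono)
      fix n assume "n \<in> {m+1..m+Suc N}"
      then have "cmod (hcoeff (a N - hmonom m) n) = cmod r ^ (n - m) / real (Suc N)"
        by (simp add: a_coeff norm_divide norm_power del: of_nat_Suc)
      also have "\<dots> \<le> 1 / real (Suc N)"
        using r by (intro divide_right_mono power_le_one) auto
      finally show "(cmod (hcoeff (a N - hmonom m) n))\<^sup>2 \<le> 1 / (real (Suc N))\<^sup>2"
        using power_mono[of _ _ 2] by (fastforce simp: power_divide)
    qed
    also have "\<dots> = 1 / real (Suc N)"
      by (simp add: power2_eq_square)
    finally show ?thesis .
  qed
  have "(\<lambda>N. (norm (a N - hmonom m))\<^sup>2) \<longlonglongrightarrow> 0"
  proof (rule tendsto_sandwich[OF _ _ tendsto_const])
    show "(\<lambda>N. 1 / real (Suc N)) \<longlonglongrightarrow> 0"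
      using LIMSEQ_inverse_real_of_nat by (simp add: inverse_eq_divide)
  qed (use bound in auto)
  then have "(\<lambda>N. norm (a N - hmonom m)) \<longlonglongrightarrow> 0"
    by (simp add: power_tendsto_0_iff)
  then have "a \<longlonglongrightarrow> hmonom m"
    unfolding tendsto_norm_zero_iff by (rule LIM_zero_cancel)
  then show ?thesis
    using closed_sequentially[OF V(1)] a_mem by blast
qed

section \<open>The cubic polynomial\<close>

text \<open>
  The cubic is \<open>x (x + 1) (x + 2) - 1\<close>.  For negative \<open>x\<close> the product can be positive only between
  \<open>-2\<close> and \<open>-1\<close>, where \<open>\<bar>x (x + 2)\<bar> \<le> 1\<close> and \<open>\<bar>x + 1\<bar> < 1\<close>.
\<close>

lemma cubic_neg:
  assumes "x \<le> 0"
  shows "poly [:-1, 2, 3, 1:] x < (0 :: real)"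
proof -
  have "x * (x + 1) * (x + 2) < 1"
  proof (cases "x \<in> {-1<..0} \<or> x \<le> -2")
    case True
    then have "x * ((x + 1) * (x + 2)) \<le> 0"
    proof
      assume "x \<in> {-1<..0}"
      then show ?thesis by (intro mult_nonpos_nonneg mult_nonneg_nonneg) auto
    next
      assume "x \<le> -2"
      then show ?thesis by (intro mult_nonpos_nonneg mult_nonpos_nonpos) auto
    qed
    then show ?thesis by (simp add: mult.assoc)
  next
    case False
    then have x: "-2 < x" "x \<le> -1"
      using assms by auto
    have "(- x * (x + 2)) * (- (x + 1)) < 1"
    proof -
      have "- x * (x + 2) \<le> 1"
        using zero_le_power2[of "x + 1"] by (simp add: power2_eq_square algebra_simps)
      then have "(- x * (x + 2)) * (- (x + 1)) \<le> 1 * (- (x + 1))"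
        using x by (intro mult_right_mono) auto
      also have "\<dots> < 1"
        using x by simp
      finally show ?thesis .
    qed
    then show ?thesis by (simp add: algebra_simps)
  qed
  then show ?thesis by (simp add: algebra_simps)
qed

lemma cubic_strict_mono:
  assumes "0 \<le> x" "x < y"
  shows "poly [:-1, 2, 3, 1:] x < poly [:-1, 2, 3, 1:] (y :: real)"
proof -
  have "x * (2 + x * (3 + x)) < y * (2 + y * (3 + y))"
    using assms by (intro mult_strict_mono' add_strict_left_mono add_nonneg_nonneg mult_nonneg_nonneg) auto
  then show ?thesis by simp
qed

lemma cubic_unique_root: "\<exists>!u::real. poly [:-1, 2, 3, 1:] u = 0"
proof (rule ex_ex1I)
  have "\<exists>u\<ge>0. u \<le> 1 \<and> poly [:-1, 2, 3, 1:] u = (0::real)"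
    by (rule IVT') (auto intro!: continuous_intros)
  then show "\<exists>u::real. poly [:-1, 2, 3, 1:] u = 0"
    by blast
next
  fix u v :: real
  assume "poly [:-1, 2, 3, 1:] u = 0" "poly [:-1, 2, 3, 1:] v = 0"
  then show "u = v"
    using cubic_neg[of u] cubic_neg[of v] cubic_strict_mono[of u v] cubic_strict_mono[of v u]
    by (cases u v rule: linorder_cases) force+
qed

text \<open>Here \<open>a = 1/(t + 1)\<close>, and the difference of the two sides is \<open>a\<^sup>3\<close> times the cubic at \<open>t\<close>.\<close>

lemma cubic_root_threshold:
  fixes a u :: real
  assumes u: "poly [:-1, 2, 3, 1:] u = 0" and a: "0 < a" "a < 1"
  shows "a \<le> (1 - a) * (1 + a)\<^sup>2 \<longleftrightarrow> a \<le> 1 / (u + 1)"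
proof -
  have u0: "u > 0"
    using cubic_neg[of u] u by force
  define t where "t = 1 / a - 1"
  have t: "t > 0" "a * (t + 1) = 1"
    using a by (auto simp: t_def field_simps)
  have "(1 - a) * (1 + a)\<^sup>2 - a = a ^ 3 * poly [:-1, 2, 3, 1:] t"
  proof -
    have eqs: "1 - a = a * t" "1 + a = a * (t + 2)"
      using t(2) by (simp_all add: algebra_simps)
    have "(1 - a) * (1 + a)\<^sup>2 - a = a * t * (a * (t + 2))\<^sup>2 - a * (a * (t + 1))\<^sup>2"
      unfolding eqs t(2) by simp
    then show ?thesis
      by (simp add: power2_eq_square power3_eq_cube algebra_simps)
  qed
  then have "a \<le> (1 - a) * (1 + a)\<^sup>2 \<longleftrightarrow> 0 \<le> a ^ 3 * poly [:-1, 2, 3, 1:] t"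
    by linarith
  also have "\<dots> \<longleftrightarrow> poly [:-1, 2, 3, 1:] u \<le> poly [:-1, 2, 3, 1:] t"
    using a u by (simp add: zero_le_mult_iff)
  also have "\<dots> \<longleftrightarrow> u \<le> t"
    using cubic_strict_mono[of u t] cubic_strict_mono[of t u] u0 t
    by (cases u t rule: linorder_cases) auto
  also have "\<dots> \<longleftrightarrow> a \<le> 1 / (u + 1)"
    using a u0 by (auto simp: t_def field_simps)
  finally show ?thesis .
qed

section \<open>The compressed shift\<close>

context
  fixes \<alpha> \<beta> :: complex
  assumes \<alpha>: "\<alpha> \<noteq> 0" and \<beta>: "\<beta> \<noteq> 0" and normalized: "(cmod \<alpha>)\<^sup>2 + (cmod \<beta>)\<^sup>2 = 1"
begin

private abbreviation (input) M where "M \<equiv> H2_sub \<alpha> \<beta>"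
private abbreviation (input) S where "S \<equiv> S_op \<alpha> \<beta>"

private definition e where "e = hscale \<alpha> (hmonom 0) + hscale \<beta> (hmonom 1)"

private lemma normalized_cnj: "\<alpha> * cnj \<alpha> + \<beta> * cnj \<beta> = 1"
  using normalized by (metis complex_norm_square of_real_1 of_real_add)

private lemma hcoeff_e: "hcoeff e n = (if n = 0 then \<alpha> else if n = 1 then \<beta> else 0)"
  by (simp add: e_def hcoeff_simps)

private lemma subspace_M: "hardy_complex.subspace M"
  unfolding H2_sub_def by (intro closure_hardy_subspace hardy_complex.subspace_span)

private lemma closed_M: "closed M"
  unfolding H2_sub_def by simp

private lemma e_mem: "e \<in> M"
  unfolding H2_sub_def e_def
  by (rule subsetD[OF closure_subset]) (auto intro: hardy_complex.span_base)

private lemma monom_mem: "n \<ge> 2 \<Longrightarrow> hmonom n \<in> M"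
  unfolding H2_sub_def by (rule subsetD[OF closure_subset]) (auto intro: hardy_complex.span_base)

text \<open>
  The first two terms of the monomial expansion combine to a multiple of \<open>e = \<alpha> + \<beta> z\<close> exactly when
  \<open>\<beta>\<close> times the constant coefficient equals \<open>\<alpha>\<close> times the linear one.
\<close>

private lemma closed_subspace_contains_if:
  assumes V: "closed V" "hardy_complex.subspace V"
    and "e \<in> V" "\<And>n. n \<ge> 2 \<Longrightarrow> hmonom n \<in> V"
    and f: "\<beta> * hcoeff f 0 = \<alpha> * hcoeff f 1"
  shows "f \<in> V"
proof -
  have split: "(\<Sum>n<N+2. hscale (hcoeff f n) (hmonom n))
      = hscale (hcoeff f 0 / \<alpha>) e + (\<Sum>n=2..<N+2. hscale (hcoeff f n) (hmonom n))" for N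
  proof -
    have "(\<Sum>n<N+2. hscale (hcoeff f n) (hmonom n)) =
      (\<Sum>n<2. hscale (hcoeff f n) (hmonom n)) + (\<Sum>n=2..<N+2. hscale (hcoeff f n) (hmonom n))"
      unfolding lessThan_atLeast0 by (rule sum.atLeastLessThan_concat[symmetric]) auto
    moreover have "(\<Sum>n<2. hscale (hcoeff f n) (hmonom n)) = hscale (hcoeff f 0 / \<alpha>) e"
      by (rule hardy_eqI) (use f \<alpha> in \<open>auto simp: hcoeff_simps hcoeff_e numeral_2_eq_2 field_simps\<close>)
    ultimately show ?thesis by simp
  qed
  have "(\<Sum>n<N+2. hscale (hcoeff f n) (hmonom n)) \<in> V" for N
    unfolding split
    by (intro hardy_complex.subspace_add[OF V(2)] hardy_complex.subspace_scale[OF V(2)]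
        hardy_complex.subspace_sum[OF V(2)] assms) auto
  moreover have "(\<lambda>N. \<Sum>n<N+2. hscale (hcoeff f n) (hmonom n)) \<longlonglongrightarrow> f"
    using LIMSEQ_ignore_initial_segment[OF monomial_expansion] .
  ultimately show ?thesis
    by (rule closed_sequentially[OF V(1)])
qed

private lemma H2_sub_iff: "f \<in> M \<longleftrightarrow> \<beta> * hcoeff f 0 = \<alpha> * hcoeff f 1"
proof
  let ?V = "{f. \<beta> * hcoeff f 0 = \<alpha> * hcoeff f 1}"
  have "closed ?V"
    by (intro closed_Collect_eq continuous_intros
        bounded_linear.continuous_on[OF bounded_linear_hcoeff])
  moreover have "hardy_complex.subspace ?V"
    by (rule hardy_complex.subspaceI) (auto simp: hcoeff_simps algebra_simps)
  ultimately have "M \<subseteq> ?V"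
    unfolding H2_sub_def by (rule closure_cspan_subset) (auto simp: hcoeff_simps)
  then show "f \<in> M \<Longrightarrow> \<beta> * hcoeff f 0 = \<alpha> * hcoeff f 1"
    by blast
qed (auto intro: closed_subspace_contains_if closed_M subspace_M e_mem monom_mem)

private lemma hinner_e: "hinner f e = hcoeff f 0 * cnj \<alpha> + hcoeff f 1 * cnj \<beta>"
  by (simp add: e_def hinner_simps)

text \<open>
  The orthogonal complement of the subspace consists of the polynomials of degree at most 1 that are
  orthogonal to the unit vector \<open>e\<close>, so projecting replaces the terms of degree 0 and 1 by their
  component along \<open>e\<close>.
\<close>

private lemma orth_proj_eq:
  "orth_proj M f = f + hscale (hinner f e) e - hscale (hcoeff f 0) (hmonom 0)
                     - hscale (hcoeff f 1) (hmonom 1)" (is "_ = ?P")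
proof (rule orth_proj_unique[OF subspace_M])
  show "?P \<in> M"
    unfolding H2_sub_iff by (simp add: hcoeff_simps hcoeff_e)
  show "hinner (f - ?P) h = 0" if "h \<in> M" for h
  proof -
    define c where "c = hcoeff h 0 / \<alpha>"
    have h: "hcoeff h 0 = c * \<alpha>" "hcoeff h 1 = c * \<beta>"
      using that \<alpha> by (auto simp: c_def H2_sub_iff field_simps)
    have left: "hinner (hmonom n) h = cnj (hcoeff h n)" for n
      by (metis hinner_commute hinner_monom)
    have "hinner e h = cnj (c * (\<alpha> * cnj \<alpha> + \<beta> * cnj \<beta>))"
      by (simp add: e_def hinner_simps left h[simplified] algebra_simps)
    then have "hinner e h = cnj c"
      by (simp add: normalized_cnj)
    then show ?thesis
      by (simp add: hinner_simps left hinner_e h[simplified] algebra_simps)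
  qed
qed

private lemma hcoeff_S:
  assumes "f \<in> M"
  shows "hcoeff (S f) n = (if n = 0 then hcoeff f 0 * cnj \<beta> * \<alpha> else
           if n = 1 then hcoeff f 0 * cnj \<beta> * \<beta> else hcoeff f (n - 1))"
  unfolding S_op_def orth_proj_eq by (simp add: hcoeff_simps hcoeff_e hinner_e)

private lemma hardy_fun_e: "z \<in> ball 0 1 \<Longrightarrow> hardy_fun e z = \<alpha> + \<beta> * z"
  by (simp add: e_def hardy_fun_simps)

private lemma hardy_fun_S:
  assumes "z \<in> ball 0 1"
  shows "hardy_fun (S f) z = z * hardy_fun f z + hcoeff f 0 * cnj \<beta> * (\<alpha> + \<beta> * z) - hcoeff f 0 * z"
  unfolding S_op_def orth_proj_eq
  using assms by (simp add: hcoeff_simps hinner_e hardy_fun_simps hardy_fun_e algebra_simps)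

private lemma S_mem: "f \<in> M \<Longrightarrow> S f \<in> M"
  by (simp add: H2_sub_iff[of "S f"] hcoeff_S)

private lemma S_pow_mem: "f \<in> M \<Longrightarrow> (S ^^ n) f \<in> M"
  by (induction n) (auto intro: S_mem)

text \<open>
  The range of \<open>S\<close> spans the same closed subspace as \<open>S e = \<alpha> \<beta>\<^sup>* e + \<beta> z\<^sup>2\<close> and \<open>z\<^sup>3, z\<^sup>4, \<dots>\<close>, so the
  vectors orthogonal to it are the \<open>c e + d z\<^sup>2\<close> orthogonal to \<open>S e\<close>.  The coefficient \<open>\<mu>\<close> is the
  value of \<open>d\<close> for \<open>c = 1\<close>.
\<close>

private definition \<mu> where "\<mu> = - (cnj \<alpha> * \<beta> / cnj \<beta>)"
private definition h where "h = e + hscale \<mu> (hmonom 2)"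

private lemma hcoeff_h:
  "hcoeff h n = (if n = 0 then \<alpha> else if n = 1 then \<beta> else if n = 2 then \<mu> else 0)"
  by (simp add: h_def hcoeff_simps hcoeff_e)

private lemma h_mem: "h \<in> M"
  unfolding H2_sub_iff by (simp add: hcoeff_h)

private lemma wandering_subspace: "M \<ominus>\<^sub>H S ` M = range (\<lambda>c. hscale c h)"
proof (intro equalityI subsetI)
  fix f assume "f \<in> M \<ominus>\<^sub>H S ` M"
  then have f: "f \<in> M" and orth: "\<And>g. g \<in> M \<Longrightarrow> hinner f (S g) = 0"
    by (auto simp: ominus_def)
  have Se: "S e = hscale (\<alpha> * cnj \<beta>) e + hscale \<beta> (hmonom 2)"
    by (rule hardy_eqI) (auto simp: hcoeff_S[OF e_mem] hcoeff_simps hcoeff_e)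
  have high: "hcoeff f n = 0" if "n \<ge> 3" for n
  proof -
    have "S (hmonom (n - 1)) = hmonom n"
      by (rule hardy_eqI) (use that in \<open>auto simp: hcoeff_S[OF monom_mem] hcoeff_simps\<close>)
    then show ?thesis
      using orth[OF monom_mem[of "n - 1"]] that by (simp add: hinner_monom)
  qed
  define c where "c = hcoeff f 0 / \<alpha>"
  have c: "hcoeff f 0 = c * \<alpha>" "hcoeff f 1 = c * \<beta>"
    using f \<alpha> by (auto simp: c_def H2_sub_iff field_simps)
  have "cnj \<alpha> * \<beta> * (c * (\<alpha> * cnj \<alpha> + \<beta> * cnj \<beta>)) + cnj \<beta> * hcoeff f 2 = 0"
    using orth[OF e_mem] by (simp add: Se hinner_simps hinner_e c[simplified] algebra_simps)
  then have "hcoeff f 2 = c * \<mu>"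
    unfolding normalized_cnj using \<beta> by (simp add: \<mu>_def field_simps add_eq_0_iff)
  then have "f = hscale c h"
    using c high
    by (intro hardy_eqI) (auto simp: h_def hcoeff_simps hcoeff_e eval_nat_numeral not_less_eq_eq
        intro: high)
  then show "f \<in> range (\<lambda>c. hscale c h)"
    by blast
next
  fix f assume "f \<in> range (\<lambda>c. hscale c h)"
  then obtain c where f: "f = hscale c h"
    by blast
  have "hinner h (S g) = 0" if g: "g \<in> M" for g
  proof -
    have "hcoeff g 1 = hcoeff g 0 / \<alpha> * \<beta>"
      using g \<alpha> by (simp add: H2_sub_iff field_simps)
    moreover have "hinner (S g) e = hcoeff g 0 * cnj \<beta> * (\<alpha> * cnj \<alpha> + \<beta> * cnj \<beta>)"
      by (simp add: hinner_e hcoeff_S[OF g] algebra_simps)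
    moreover have "cnj \<mu> * (hcoeff g 0 / \<alpha> * \<beta>) = - (hcoeff g 0 * cnj \<beta>)"
      using \<alpha> \<beta> by (simp add: \<mu>_def)
    ultimately have "hinner (S g) h = 0"
      unfolding normalized_cnj by (simp add: h_def hinner_simps hcoeff_S[OF g])
    then show ?thesis
      by (subst hinner_commute) simp
  qed
  then show "f \<in> M \<ominus>\<^sub>H S ` M"
    using h_mem by (auto simp: f ominus_def hinner_scale_left intro: hardy_complex.subspace_scale[OF subspace_M])
qed

text \<open>
  On \<open>z\<^sup>2, z\<^sup>3, \<dots>\<close> the operator is multiplication by \<open>z\<close>, and \<open>S - \<alpha> \<beta>\<^sup>*\<close> sends \<open>e\<close> to \<open>\<beta> z\<^sup>2\<close>.  It
  therefore sends \<open>h\<close> to \<open>z\<^sup>2 (A + \<mu> z)\<close> with the following \<open>A\<close>, and the zero of \<open>A + \<mu> z\<close> decides the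
  question.
\<close>

private definition A where "A = \<beta> * (1 + \<alpha> * cnj \<alpha>)"

private lemma A_eq: "A = \<beta> - \<alpha> * cnj \<beta> * \<mu>"
proof -
  have "cnj \<beta> * \<mu> = - (cnj \<alpha> * \<beta>)"
    using \<beta> by (simp add: \<mu>_def)
  then show ?thesis
    by (simp add: A_def mult.assoc distrib_left mult.left_commute mult.commute)
qed

private lemma S_pow_h:
  "(S ^^ Suc n) h = hscale (\<alpha> * cnj \<beta>) ((S ^^ n) h)
       + (hscale A (hmonom (n + 2)) + hscale \<mu> (hmonom (n + 3)))"
proof (induction n)
  case 0
  show ?case
    by (intro hardy_eqI) (auto simp: hcoeff_S[OF h_mem] hcoeff_simps hcoeff_h A_eq algebra_simps)
next
  case (Suc n)
  define p where "p = hscale (\<alpha> * cnj \<beta>) ((S ^^ n) h)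
       + (hscale A (hmonom (n + 2)) + hscale \<mu> (hmonom (n + 3)))"
  have p: "(S ^^ Suc n) h = p"
    unfolding p_def by (rule Suc)
  have "p \<in> M"
    using S_pow_mem[OF h_mem, of "Suc n"] unfolding p .
  then have "S p = hscale (\<alpha> * cnj \<beta>) (S ((S ^^ n) h))
       + (hscale A (hmonom (Suc n + 2)) + hscale \<mu> (hmonom (Suc n + 3)))"
    by (intro hardy_eqI) (auto simp: hcoeff_S S_pow_mem[OF h_mem] p_def hcoeff_simps)
  then show ?case
    using p by simp
qed

private abbreviation (input) K where "K \<equiv> generated S (M \<ominus>\<^sub>H S ` M)"

private lemma K_subspace: "hardy_complex.subspace K"
  unfolding generated_def by (intro closure_hardy_subspace hardy_complex.subspace_span)

private lemma K_closed: "closed K"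
  unfolding generated_def by simp

private lemma S_pow_h_mem_K: "(S ^^ n) h \<in> K"
proof -
  have "h \<in> M \<ominus>\<^sub>H S ` M"
    unfolding wandering_subspace by (metis hardy_complex.scale_one rangeI)
  then show ?thesis
    unfolding generated_def
    by (intro subsetD[OF closure_subset] hardy_complex.span_base) blast
qed

private lemma K_subset_M: "K \<subseteq> M"
  unfolding generated_def
  by (rule closure_cspan_subset[OF closed_M subspace_M]) (auto simp: ominus_def S_pow_mem)

private lemma A_nonzero: "A \<noteq> 0"
proof -
  have "1 + \<alpha> * cnj \<alpha> = of_real (1 + (cmod \<alpha>)\<^sup>2)"
    by (simp flip: complex_norm_square)
  also have "\<dots> \<noteq> 0"
    unfolding of_real_eq_0_iff using zero_le_power2[of "cmod \<alpha>"] by linarith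
  finally show ?thesis
    using \<beta> by (simp add: A_def)
qed

private lemma generates_if_outer:
  assumes "cmod \<mu> \<le> cmod A"
  shows "K = M"
proof -
  have "hmonom m \<in> K" if "m \<ge> 2" for m
  proof (rule monom_mem_if_outer[OF K_closed K_subspace, where r = "\<mu> / A"])
    show "cmod (\<mu> / A) \<le> 1"
      using assms A_nonzero by (simp add: norm_divide)
    fix k assume "k \<ge> m"
    define n where "n = k - 2"
    have k: "k = n + 2" "Suc k = n + 3"
      using \<open>k \<ge> m\<close> that by (auto simp: n_def)
    have "hscale A (hmonom k) + hscale \<mu> (hmonom (Suc k))
            = (S ^^ Suc n) h - hscale (\<alpha> * cnj \<beta>) ((S ^^ n) h)"
      unfolding k(2) unfolding k(1) S_pow_h by simp
    also have "\<dots> \<in> K"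
      by (intro hardy_complex.subspace_diff[OF K_subspace]
          hardy_complex.subspace_scale[OF K_subspace] S_pow_h_mem_K)
    finally have "hscale A (hmonom k) + hscale \<mu> (hmonom (Suc k)) \<in> K" .
    then have "hscale (1 / A) (hscale A (hmonom k) + hscale \<mu> (hmonom (Suc k))) \<in> K"
      by (rule hardy_complex.subspace_scale[OF K_subspace])
    then show "hmonom k + hscale (\<mu> / A) (hmonom (Suc k)) \<in> K"
      using A_nonzero by (simp add: hardy_complex.scale_right_distrib)
  qed
  moreover from this have "e \<in> K"
    using hardy_complex.subspace_diff[OF K_subspace S_pow_h_mem_K[of 0]
        hardy_complex.subspace_scale[OF K_subspace, of "hmonom 2" \<mu>]] by (simp add: h_def)
  ultimately have "M \<subseteq> K"
    by (auto simp: H2_sub_iff intro: closed_subspace_contains_if[OF K_closed K_subspace])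
  then show ?thesis
    using K_subset_M by blast
qed

text \<open>
  Let \<open>w\<close> be the zero of \<open>A + \<mu> z\<close> and \<open>\<lambda> = \<alpha> \<beta>\<^sup>*\<close>.  The functional that sends \<open>c e + z\<^sup>2 g\<close> to
  \<open>c \<beta> + (w - \<lambda>) g(w)\<close> is the value at \<open>w\<close> of \<open>z - \<lambda>\<close> times the model function
  \<open>c \<beta>/(z - \<lambda>) + g\<close>, so applying \<open>S\<close> first multiplies it by \<open>w\<close>.  On the subspace, \<open>\<Phi>\<close> below is \<open>w\<^sup>2\<close>
  times this functional, written in terms of the value at \<open>w\<close> and the constant coefficient.
\<close>

private lemma not_generates_if_not_outer:
  assumes "cmod A < cmod \<mu>"
  shows "K \<noteq> M"
proof -
  define w where "w = - A / \<mu>"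
  define \<Phi> where
    "\<Phi> f = (w - \<alpha> * cnj \<beta>) * hardy_fun f w + (\<alpha> * cnj \<beta> - w * (\<alpha> * cnj \<alpha>)) * hcoeff f 0" for f
  have \<mu>0: "\<mu> \<noteq> 0"
    using assms by auto
  have w: "w \<in> ball 0 1" and w0: "w \<noteq> 0"
    using assms A_nonzero \<mu>0 by (auto simp: w_def norm_divide)
  have zero: "A + \<mu> * w = 0"
    using \<mu>0 by (simp add: w_def)
  have aa: "\<alpha> * cnj \<alpha> = 1 - \<beta> * cnj \<beta>"
    using normalized_cnj by (simp add: algebra_simps)
  have \<Phi>_S: "\<Phi> (S f) = w * \<Phi> f" if "f \<in> M" for f
    unfolding \<Phi>_def hardy_fun_S[OF w] aa
    by (simp add: hcoeff_S[OF that] algebra_simps)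
  have \<Phi>_e: "\<Phi> e = \<beta> * w\<^sup>2"
    unfolding \<Phi>_def hardy_fun_e[OF w] aa by (simp add: hcoeff_e algebra_simps power2_eq_square)
  have \<Phi>_h: "\<Phi> h = 0"
  proof -
    have "\<Phi> h = \<Phi> e + (w - \<alpha> * cnj \<beta>) * \<mu> * w\<^sup>2"
      using w by (simp add: \<Phi>_def h_def hardy_fun_simps hcoeff_simps algebra_simps)
    then have "\<Phi> h = w\<^sup>2 * (A + \<mu> * w)"
      unfolding \<Phi>_e A_eq by (simp only: algebra_simps)
    then show ?thesis using zero by simp
  qed
  have \<Phi>_scale: "\<Phi> (hscale c f) = c * \<Phi> f" for c f
    by (simp add: \<Phi>_def hardy_fun_simps hcoeff_simps algebra_simps)
  let ?V = "{f. \<Phi> f = 0}"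
  have "closed ?V"
    unfolding \<Phi>_def
    by (intro closed_Collect_eq continuous_intros
        bounded_linear.continuous_on[OF bounded_linear_hcoeff]
        bounded_linear.continuous_on[OF bounded_linear_hardy_eval[OF w]])
  moreover have "hardy_complex.subspace ?V"
  proof (rule hardy_complex.subspaceI)
    show "0 \<in> ?V"
      using \<Phi>_scale[of 0 0] by simp
    show "f + g \<in> ?V" if "f \<in> ?V" "g \<in> ?V" for f g
    proof -
      have "\<Phi> (f + g) = \<Phi> f + \<Phi> g"
        by (simp add: \<Phi>_def hardy_fun_simps hcoeff_simps algebra_simps)
      then show ?thesis using that by simp
    qed
  qed (simp add: \<Phi>_scale)
  moreover have "\<Phi> ((S ^^ n) (hscale c h)) = 0" for n c
  proof (induction n)
    case 0
    then show ?case by (simp add: \<Phi>_scale \<Phi>_h)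
  next
    case (Suc n)
    then show ?case
      using \<Phi>_S[OF S_pow_mem[OF hardy_complex.subspace_scale[OF subspace_M h_mem]]] by simp
  qed
  ultimately have "K \<subseteq> ?V"
    unfolding generated_def wandering_subspace by (intro closure_cspan_subset) auto
  moreover have "\<Phi> e \<noteq> 0"
    using \<beta> w0 by (simp add: \<Phi>_e)
  ultimately show ?thesis
    using e_mem by blast
qed

private lemma outer_iff:
  "cmod \<mu> \<le> cmod A \<longleftrightarrow> (cmod \<alpha>)\<^sup>2 \<le> (1 - (cmod \<alpha>)\<^sup>2) * (1 + (cmod \<alpha>)\<^sup>2)\<^sup>2"
proof -
  have "1 + \<alpha> * cnj \<alpha> = of_real (1 + (cmod \<alpha>)\<^sup>2)"
    by (simp flip: complex_norm_square)
  then have "cmod A = cmod \<beta> * (1 + (cmod \<alpha>)\<^sup>2)"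
    unfolding A_def norm_mult by (simp only: norm_of_real) simp
  moreover have "cmod \<mu> = cmod \<alpha>"
    using \<beta> by (simp add: \<mu>_def norm_mult norm_divide)
  moreover have "(cmod \<beta>)\<^sup>2 = 1 - (cmod \<alpha>)\<^sup>2"
    using normalized by simp
  moreover have "cmod \<mu> \<le> cmod A \<longleftrightarrow> (cmod \<mu>)\<^sup>2 \<le> (cmod A)\<^sup>2"
    by (simp add: power_mono_iff)
  ultimately show ?thesis
    by (simp add: power_mult_distrib)
qed

lemma generates_iff:
  "H2_sub \<alpha> \<beta> = generated (S_op \<alpha> \<beta>) (H2_sub \<alpha> \<beta> \<ominus>\<^sub>H S_op \<alpha> \<beta> ` H2_sub \<alpha> \<beta>) \<longleftrightarrow>
     (cmod \<alpha>)\<^sup>2 \<le> (1 - (cmod \<alpha>)\<^sup>2) * (1 + (cmod \<alpha>)\<^sup>2)\<^sup>2"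
  using generates_if_outer not_generates_if_not_outer outer_iff by (metis not_le)

end

theorem theorem5p2:
  fixes \<alpha> \<beta> :: complex
  assumes "\<alpha> \<noteq> 0" and "\<beta> \<noteq> 0" and "(cmod \<alpha>)\<^sup>2 + (cmod \<beta>)\<^sup>2 = 1"
  shows "(\<exists>!u::real. poly [:-1, 2, 3, 1:] u = 0) \<and>
         (\<forall>u::real. poly [:-1, 2, 3, 1:] u = 0 \<longrightarrow>
            (H2_sub \<alpha> \<beta> = generated (S_op \<alpha> \<beta>) (H2_sub \<alpha> \<beta> \<ominus>\<^sub>H S_op \<alpha> \<beta> ` H2_sub \<alpha> \<beta>) \<longleftrightarrow>
             (cmod \<alpha>)\<^sup>2 \<le> 1 / (u + 1)))"
proof (intro conjI allI impI)
  show "\<exists>!u::real. poly [:-1, 2, 3, 1:] u = 0"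
    by (rule cubic_unique_root)
next
  fix u :: real
  assume "poly [:-1, 2, 3, 1:] u = 0"
  moreover have "0 < (cmod \<alpha>)\<^sup>2" "0 < (cmod \<beta>)\<^sup>2"
    using assms by auto
  then have "0 < (cmod \<alpha>)\<^sup>2" "(cmod \<alpha>)\<^sup>2 < 1"
    using assms(3) by linarith+
  ultimately show "H2_sub \<alpha> \<beta> = generated (S_op \<alpha> \<beta>) (H2_sub \<alpha> \<beta> \<ominus>\<^sub>H S_op \<alpha> \<beta> ` H2_sub \<alpha> \<beta>) \<longleftrightarrow>
             (cmod \<alpha>)\<^sup>2 \<le> 1 / (u + 1)"
    unfolding generates_iff[OF assms] by (rule cubic_root_threshold)
qed

end
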